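(* Let $R$ be a left quasi-duo ring such that every prime ideal of $R$ is maximal. Then $R$ is $P$-symmetric.
   Context: Rings are associative with identity (not necessarily commutative). A ring $R$ is left quasi-duo if every maximal left ideal of $R$ is a two-sided ideal. "Ideal" means two-sided ideal; an ideal $P$ of $R$ is prime if it is proper and for any ideals $A,B$ of $R$ with $AB\subseteq P$, either $A\subseteq P$ or $B\subseteq P$. $P(R)$ denotes the prime radical of $R$ (the intersection of all prime ideals of $R$). A ring $R$ is $P$-symmetric if for any $a,b,c\in R$, $abc=0$ implies $bac\in P(R)$. *)

theory Defs
  imports "HOL-Algebra.Algebra"
begin

text \<open>
  HOL-Algebra rings are associative with identity and not necessarily commutative; its \<open>ideal\<close> and
  \<open>maximalideal\<close> are two-sided. The zero ring is a ring.
\<close>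

locale left_ideal = additive_subgroup I R + ring R for I and R (structure) +
  assumes l_closed: "\<lbrakk>a \<in> I; x \<in> carrier R\<rbrakk> \<Longrightarrow> x \<otimes> a \<in> I"

locale maximal_left_ideal = left_ideal +
  assumes proper: "I \<noteq> carrier R"
    and maximal: "\<lbrakk>left_ideal J R; I \<subseteq> J\<rbrakk> \<Longrightarrow> J = I \<or> J = carrier R"

definition left_quasi_duo :: "('a, 'b) ring_scheme \<Rightarrow> bool"
  where "left_quasi_duo R \<longleftrightarrow> ring R \<and> (\<forall>I. maximal_left_ideal I R \<longrightarrow> ideal I R)"

text \<open>
  The library's \<open>primeideal\<close> is elementwise and restricted to commutative rings, so the prime
  ideals of noncommutative ring theory are defined here through the ideal product.
\<close>

locale nc_prime_ideal = ideal P R for P and R (structure) +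
  assumes proper: "P \<noteq> carrier R"
    and prime: "\<lbrakk>ideal A R; ideal B R; A \<cdot> B \<subseteq> P\<rbrakk> \<Longrightarrow> A \<subseteq> P \<or> B \<subseteq> P"

text \<open>
  Intersecting with the carrier makes the empty intersection (no prime ideals) the whole ring.
\<close>

definition prime_radical :: "('a, 'b) ring_scheme \<Rightarrow> 'a set"
  where "prime_radical R = carrier R \<inter> \<Inter>{P. nc_prime_ideal P R}"

definition P_symmetric :: "('a, 'b) ring_scheme \<Rightarrow> bool"
  where "P_symmetric R \<longleftrightarrow> ring R \<and>
    (\<forall>a \<in> carrier R. \<forall>b \<in> carrier R. \<forall>c \<in> carrier R.
      a \<otimes>\<^bsub>R\<^esub> b \<otimes>\<^bsub>R\<^esub> c = \<zero>\<^bsub>R\<^esub> \<longrightarrow> b \<otimes>\<^bsub>R\<^esub> a \<otimes>\<^bsub>R\<^esub> c \<in> prime_radical R)"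

end

theory Submission
  imports Defs
begin

text \<open>
  A prime ideal \<open>P\<close> lies in a maximal left ideal, which is two-sided by the quasi-duo hypothesis and
  hence equals the maximal ideal \<open>P\<close>. So \<open>P\<close> is a maximal left ideal that is two-sided, and therefore
  completely prime: if \<open>x y \<in> P\<close>, the left ideal \<open>{z. z y \<in> P}\<close> contains \<open>P\<close> and \<open>x\<close>, so either it
  is \<open>P\<close> and \<open>x \<in> P\<close>, or it contains \<open>1\<close> and \<open>y \<in> P\<close>. Complete primeness of every prime ideal makes
  membership of a product in the prime radical independent of the order of the factors.
\<close>

text \<open>Closure under negation comes from the absorption law: \<open>\<ominus> x\<close> is the
  left multiple of \<open>x\<close> by \<open>\<ominus> \<one>\<close>.\<close>

lemma left_idealI:
  fixes R (structure)
  assumes "ring R" "J \<subseteq> carrier R" "\<zero> \<in> J"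
    and add: "\<And>x y. \<lbrakk>x \<in> J; y \<in> J\<rbrakk> \<Longrightarrow> x \<oplus> y \<in> J"
    and mult: "\<And>a x. \<lbrakk>a \<in> J; x \<in> carrier R\<rbrakk> \<Longrightarrow> x \<otimes> a \<in> J"
  shows "left_ideal J R"
proof -
  interpret ring R by fact
  have "\<ominus> x \<in> J" if "x \<in> J" for x
  proof -
    have "\<ominus> x = (\<ominus> \<one>) \<otimes> x"
      using that assms(2) by (simp add: subset_iff l_minus)
    then show ?thesis
      using mult[OF that, of "\<ominus> \<one>"] by simp
  qed
  then have "subgroup J (add_monoid R)"
    using assms by (intro add.subgroupI) (auto simp: a_inv_def)
  then show ?thesis
    using mult by unfold_locales (auto simp: subgroup_def)
qed

lemma (in ideal) left_ideal: "left_ideal I R"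
  by (rule left_idealI) (use a_subset ring_axioms I_l_closed in auto)

lemma (in left_ideal) one_imp_carrier:
  assumes "\<one> \<in> I"
  shows "I = carrier R"
  using assms l_closed a_subset by fastforce

text \<open>Zorn's lemma, applied to the proper left ideals above \<open>I\<close>.\<close>

lemma (in left_ideal) ex_maximal_left_ideal:
  assumes "I \<noteq> carrier R"
  obtains M where "maximal_left_ideal M R" "I \<subseteq> M"
proof -
  \<comment> \<open>Properness is expressed as \<open>\<one> \<notin> J\<close>, a condition that
    passes to unions of chains.\<close>
  define S where "S = {J. left_ideal J R \<and> I \<subseteq> J \<and> \<one> \<notin> J}"
  have mem: "I \<in> S"
    using left_ideal_axioms one_imp_carrier assms by (auto simp: S_def)
  have "\<Union>C \<in> S" if "C \<noteq> {}" and "subset.chain S C" for C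
  proof -
    have CS: "left_ideal J R" "I \<subseteq> J" "\<one> \<notin> J" if "J \<in> C" for J
      using that \<open>subset.chain S C\<close> by (auto simp: S_def subset_chain_def)
    have "left_ideal (\<Union>C) R"
    proof (rule left_idealI[OF ring_axioms])
      show "\<Union>C \<subseteq> carrier R"
        using CS(1) left_ideal.axioms(1) additive_subgroup.a_subset by blast
      show "\<zero> \<in> \<Union>C"
        using \<open>C \<noteq> {}\<close> CS(2) additive_subgroup.zero_closed[OF additive_subgroup_axioms] by blast
    next
      fix x y assume "x \<in> \<Union>C" "y \<in> \<Union>C"
      then obtain A B where "A \<in> C" "x \<in> A" "B \<in> C" "y \<in> B"
        by blast
      moreover from this have "A \<subseteq> B \<or> B \<subseteq> A"
        using \<open>subset.chain S C\<close> by (auto simp: subset_chain_def)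
      ultimately obtain J where J: "J \<in> C" "x \<in> J" "y \<in> J"
        by blast
      interpret J: left_ideal J R
        using CS(1) J(1) .
      show "x \<oplus> y \<in> \<Union>C"
        using J by blast
    next
      fix a x assume "a \<in> \<Union>C" "x \<in> carrier R"
      then show "x \<otimes> a \<in> \<Union>C"
        using left_ideal.l_closed[OF CS(1)] by blast
    qed
    then show ?thesis
      using CS(2,3) \<open>C \<noteq> {}\<close> unfolding S_def by blast
  qed
  then obtain M where M: "M \<in> S" and max: "\<And>J. \<lbrakk>J \<in> S; M \<subseteq> J\<rbrakk> \<Longrightarrow> J = M"
    using subset_Zorn_nonempty[of S] mem by blast
  interpret M: left_ideal M R
    using M by (simp add: S_def)
  have "maximal_left_ideal M R"
  proof
    show "M \<noteq> carrier R"
      using M by (auto simp: S_def)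
  next
    fix J assume "left_ideal J R" "M \<subseteq> J"
    then show "J = M \<or> J = carrier R"
      \<comment> \<open>If \<open>J\<close> omits \<open>\<one>\<close>, it belongs to
        \<open>S\<close> and equals \<open>M\<close>; otherwise it is the whole ring.\<close>
      using max[of J] M left_ideal.one_imp_carrier[of J R] by (auto simp: S_def)
  qed
  with M show thesis
    by (intro that) (auto simp: S_def)
qed

lemma maximalideal_imp_maximal_left_ideal:
  fixes R (structure)
  assumes "left_quasi_duo R" "maximalideal P R"
  shows "maximal_left_ideal P R"
proof -
  interpret maximalideal P R by fact
  obtain M where M: "maximal_left_ideal M R" "P \<subseteq> M"
    using left_ideal.ex_maximal_left_ideal[OF left_ideal I_notcarr[symmetric]] by blast
  interpret M: maximal_left_ideal M R by fact
  have "ideal M R"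
    using assms(1) M(1) by (simp add: left_quasi_duo_def)
  then have "M = P"
    using I_maximal[of M] M(2) M.a_subset M.proper by blast
  with M(1) show ?thesis by simp
qed

lemma maximal_left_ideal_completely_prime:
  fixes R (structure)
  assumes "maximal_left_ideal P R" "ideal P R"
    and "x \<in> carrier R" "y \<in> carrier R" "x \<otimes> y \<in> P"
  shows "x \<in> P \<or> y \<in> P"
proof -
  interpret ideal P R by fact
  define K where "K = {z \<in> carrier R. z \<otimes> y \<in> P}"
  have "left_ideal K R"
    by (rule left_idealI)
      (use assms(4) ring_axioms in \<open>auto simp: K_def l_distr m_assoc I_l_closed\<close>)
  \<comment> \<open>Two-sidedness enters here: \<open>P\<close> must absorb the right factor
    \<open>y\<close>.\<close>
  moreover have "P \<subseteq> K"
    using a_subset assms(4) I_r_closed by (auto simp: K_def)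
  ultimately have "K = P \<or> K = carrier R"
    using maximal_left_ideal.maximal[OF assms(1)] by blast
  moreover have "x \<in> K"
    using assms by (simp add: K_def)
  moreover have "y \<in> P" if "K = carrier R"
  proof -
    have "\<one> \<in> K" using that by simp
    then show ?thesis using assms(4) by (simp add: K_def)
  qed
  ultimately show ?thesis by blast
qed

theorem theorem2p6:
  fixes R (structure)
  assumes "ring R"
    and "left_quasi_duo R"
    and "\<And>P. nc_prime_ideal P R \<Longrightarrow> maximalideal P R"
  shows "P_symmetric R"
proof -
  interpret ring R by fact
  have "b \<otimes> a \<otimes> c \<in> P"
    if P: "nc_prime_ideal P R" and abc: "a \<in> carrier R" "b \<in> carrier R" "c \<in> carrier R"
      and zero: "a \<otimes> b \<otimes> c = \<zero>" for P a b c
  proof -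
    interpret P: ideal P R
      using P by (rule nc_prime_ideal.axioms)
    note completely_prime = maximal_left_ideal_completely_prime
      [OF maximalideal_imp_maximal_left_ideal[OF assms(2) assms(3)[OF P]] P.ideal_axioms]
    have "a \<otimes> b \<otimes> c \<in> P"
      using zero by simp
    \<comment> \<open>Complete primeness is applied twice, first to \<open>a \<otimes> b\<close> and
      \<open>c\<close>, then to \<open>a\<close> and \<open>b\<close>.\<close>
    then have "a \<in> P \<or> b \<in> P \<or> c \<in> P"
      using completely_prime abc by blast
    \<comment> \<open>Whichever factor lies in \<open>P\<close>, the two-sided ideal absorbs the
      other two on either side, so their order is immaterial.\<close>
    then show ?thesis
      using abc P.I_l_closed P.I_r_closed by (elim disjE) simp_all
  qed
  then show ?thesis
    using ring_axioms by (auto simp: P_symmetric_def prime_radical_def)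
qed

end
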